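(* Let $k\ge 2$ and $d\ge 1$ be integers. Then for all sufficiently large $n$ there exists a partition $\{B^1,\dots,B^m\}$ of $[n]^d$ into proper bricks having the $k$-piercing property with $m\le 3.92^{d}k$.
   Context: $[n]=\{1,\dots,n\}$. A brick in $[n]^d$ is a set $B=B_1\times\cdots\times B_d$ where each $B_i\subseteq[n]$ is an interval of integers $\{a,a+1,\dots,b\}$ with $a\le b$; it is proper if $B_i\neq[n]$ for every $i$. An axis-parallel line in $[n]^d$ is a set of the form $\{x\in[n]^d : x_j=c_j \text{ for all } j\neq i\}$ for some $i\in[d]$ and fixed $c_j\in[n]$. A partition $\{B^1,\dots,B^m\}$ of $[n]^d$ has the $k$-piercing property if every axis-parallel line intersects at least $k$ distinct $B^j$. *)

theory Defs
  imports Complex_Main "HOL-Library.FuncSet" "HOL-Library.Disjoint_Sets"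
begin

text \<open>Points of the grid are functions on \<open>{1..d}\<close>, extended by \<open>undefined\<close> outside, so
  that products of sets are the library's \<^const>\<open>PiE\<close>.\<close>

definition grid :: "nat \<Rightarrow> nat \<Rightarrow> (nat \<Rightarrow> nat) set" where
  "grid n d = {1..d} \<rightarrow>\<^sub>E {1..n}"

definition interval_in :: "nat \<Rightarrow> nat set \<Rightarrow> bool" where
  "interval_in n I \<longleftrightarrow> (\<exists>a b. a \<le> b \<and> I = {a..b} \<and> I \<subseteq> {1..n})"

text \<open>The factors of a brick are nonempty, hence uniquely determined by the brick on \<open>{1..d}\<close>;
  so properness does not depend on the chosen representation.\<close>

definition proper_brick :: "nat \<Rightarrow> nat \<Rightarrow> (nat \<Rightarrow> nat) set \<Rightarrow> bool" where
  "proper_brick n d B \<longleftrightarrow>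
     (\<exists>F. B = Pi\<^sub>E {1..d} F \<and> (\<forall>i\<in>{1..d}. interval_in n (F i) \<and> F i \<noteq> {1..n}))"

definition axis_parallel_line :: "nat \<Rightarrow> nat \<Rightarrow> (nat \<Rightarrow> nat) set \<Rightarrow> bool" where
  "axis_parallel_line n d L \<longleftrightarrow>
     (\<exists>i\<in>{1..d}. \<exists>c. (\<forall>j\<in>{1..d} - {i}. c j \<in> {1..n}) \<and>
        L = {x \<in> grid n d. \<forall>j\<in>{1..d} - {i}. x j = c j})"

definition k_piercing :: "nat \<Rightarrow> nat \<Rightarrow> nat \<Rightarrow> (nat \<Rightarrow> nat) set set \<Rightarrow> bool" where
  "k_piercing n d k P \<longleftrightarrow>
     (\<forall>L. axis_parallel_line n d L \<longrightarrow> k \<le> card {B \<in> P. B \<inter> L \<noteq> {}})"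

end

theory Submission
  imports Defs
begin

text \<open>Call a partition of \<open>[N]\<^sup>d\<close> into boxes, each labelled by a direction, good if every line meets a
  box labelled with the direction of the line. For large \<open>n\<close>, blowing it up and cutting each box
  into \<open>k\<close> slices orthogonal to its label yields a \<open>k\<close>-piercing partition with \<open>k\<close> times as many
  bricks, and for \<open>k \<ge> 2\<close> piercing forces the bricks to be proper.

  Let \<open>g(d)\<close> be the least size of a good partition. Cutting every box in two gives a good
  partition in two colours, and the product of two of these can be labelled; hence
  \<open>g(d + d') \<le> 4 g(d) g(d')\<close>. With \<open>g(1) = 1\<close> and an explicit good partition of \<open>[4]\<^sup>3\<close> into 15 boxes,
  \<open>g(d + 3) \<le> 60 g(d)\<close>, and \<open>60 < 3.92\<^sup>3\<close>.\<close>

section \<open>Partitions into labelled and coloured boxes\<close>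

text \<open>The boxes \<open>F j\<close> are products over the set \<open>D\<close> of directions; \<open>l\<close> is the label and \<open>c\<close> the colour.
  Points are arbitrary functions, of which only the values on \<open>D\<close> matter, so that a point of a
  product grid is also a point of both factors.\<close>

definition piercing_scheme ::
  "nat \<Rightarrow> nat set \<Rightarrow> nat \<Rightarrow> 'a set \<Rightarrow> ('a \<Rightarrow> nat \<Rightarrow> nat set) \<Rightarrow> ('a \<Rightarrow> nat) \<Rightarrow> ('a \<Rightarrow> nat) \<Rightarrow> bool"
where
  "piercing_scheme n D r J F l c \<longleftrightarrow>
     finite J \<and>
     (\<forall>j\<in>J. l j \<in> D \<and> c j < r \<and> (\<forall>i\<in>D. interval_in n (F j i))) \<and>
     (\<forall>x \<in> D \<rightarrow> {1..n}. \<exists>!j. j \<in> J \<and> x \<in> Pi D (F j)) \<and>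
     (\<forall>x \<in> D \<rightarrow> {1..n}. \<forall>i\<in>D. \<forall>q<r. \<exists>j\<in>J. l j = i \<and> c j = q \<and> x \<in> Pi (D - {i}) (F j))"

lemma
  assumes "piercing_scheme n D r J F l c"
  shows scheme_finite: "finite J"
    and scheme_label: "j \<in> J \<Longrightarrow> l j \<in> D"
    and scheme_colour: "j \<in> J \<Longrightarrow> c j < r"
    and scheme_interval: "j \<in> J \<Longrightarrow> i \<in> D \<Longrightarrow> interval_in n (F j i)"
    and scheme_ex: "x \<in> D \<rightarrow> {1..n} \<Longrightarrow> \<exists>j\<in>J. x \<in> Pi D (F j)"
    and scheme_unique:
      "x \<in> D \<rightarrow> {1..n} \<Longrightarrow> j \<in> J \<Longrightarrow> j' \<in> J \<Longrightarrow> x \<in> Pi D (F j) \<Longrightarrow> x \<in> Pi D (F j') \<Longrightarrow> j = j'"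
    and scheme_pierce: "x \<in> D \<rightarrow> {1..n} \<Longrightarrow> i \<in> D \<Longrightarrow> q < r \<Longrightarrow>
      \<exists>j\<in>J. l j = i \<and> c j = q \<and> x \<in> Pi (D - {i}) (F j)"
  using assms unfolding piercing_scheme_def by blast+

lemma piercing_schemeI:
  assumes "finite J"
    and "\<And>j. j \<in> J \<Longrightarrow> l j \<in> D"
    and "\<And>j. j \<in> J \<Longrightarrow> c j < r"
    and "\<And>j i. j \<in> J \<Longrightarrow> i \<in> D \<Longrightarrow> interval_in n (F j i)"
    and "\<And>x. x \<in> D \<rightarrow> {1..n} \<Longrightarrow> \<exists>j\<in>J. x \<in> Pi D (F j)"
    and "\<And>x j j'. x \<in> D \<rightarrow> {1..n} \<Longrightarrow> j \<in> J \<Longrightarrow> j' \<in> J \<Longrightarrow>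
      x \<in> Pi D (F j) \<Longrightarrow> x \<in> Pi D (F j') \<Longrightarrow> j = j'"
    and "\<And>x i q. x \<in> D \<rightarrow> {1..n} \<Longrightarrow> i \<in> D \<Longrightarrow> q < r \<Longrightarrow>
      \<exists>j\<in>J. l j = i \<and> c j = q \<and> x \<in> Pi (D - {i}) (F j)"
  shows "piercing_scheme n D r J F l c"
proof -
  have "\<exists>!j. j \<in> J \<and> x \<in> Pi D (F j)" if "x \<in> D \<rightarrow> {1..n}" for x
    using assms(5)[OF that] assms(6)[OF that] by blast
  then show ?thesis
    unfolding piercing_scheme_def using assms(1-4,7) by blast
qed

text \<open>Slicing and products index boxes by pairs; reindexing brings them back to natural
  numbers, so that the constructions can be iterated.\<close>

lemma piercing_scheme_reindex:
  assumes S: "piercing_scheme n D r J F l c" and h: "bij_betw h K J"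
  shows "piercing_scheme n D r K (F \<circ> h) (l \<circ> h) (c \<circ> h)"
proof (rule piercing_schemeI)
  have hK: "h k \<in> J" if "k \<in> K" for k
    using h that by (rule bij_betwE[rule_format])
  have surj: "\<exists>k\<in>K. h k = j" if "j \<in> J" for j
    using h that by (auto simp: bij_betw_def)
  show "finite K"
    using bij_betw_finite[OF h] scheme_finite[OF S] by simp
  show "(l \<circ> h) j \<in> D" "(c \<circ> h) j < r" if "j \<in> K" for j
    using scheme_label[OF S hK[OF that]] scheme_colour[OF S hK[OF that]] by auto
  show "interval_in n ((F \<circ> h) j i)" if "j \<in> K" "i \<in> D" for j i
    using scheme_interval[OF S hK[OF that(1)] that(2)] by simp
  show "\<exists>j\<in>K. x \<in> Pi D ((F \<circ> h) j)" if "x \<in> D \<rightarrow> {1..n}" for x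
    using scheme_ex[OF S that] surj by fastforce
  show "j = j'" if "x \<in> D \<rightarrow> {1..n}" "j \<in> K" "j' \<in> K"
    "x \<in> Pi D ((F \<circ> h) j)" "x \<in> Pi D ((F \<circ> h) j')" for x j j'
    using scheme_unique[OF S that(1) hK[OF that(2)] hK[OF that(3)]] that
      bij_betw_imp_inj_on[OF h] by (auto simp: inj_on_def)
  show "\<exists>j\<in>K. (l \<circ> h) j = i \<and> (c \<circ> h) j = q \<and> x \<in> Pi (D - {i}) ((F \<circ> h) j)"
    if "x \<in> D \<rightarrow> {1..n}" "i \<in> D" "q < r" for x i q
    using scheme_pierce[OF S that] surj by (metis comp_apply)
qed

section \<open>Blowing up a grid and slicing its boxes\<close>

text \<open>All slices except the last are single points; the last takes the rest of the
  interval.\<close>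

lemma interval_in_slices:
  assumes "interval_in n I" "0 < r" "r \<le> card I"
  shows "\<exists>p. (\<forall>q<r. interval_in n (p q) \<and> p q \<subseteq> I) \<and> (\<forall>v\<in>I. \<exists>q<r. v \<in> p q) \<and>
    (\<forall>v. \<forall>q<r. \<forall>q'<r. v \<in> p q \<longrightarrow> v \<in> p q' \<longrightarrow> q = q')"
proof -
  obtain a b where I: "I = {a..b}" "{a..b} \<subseteq> {1..n}"
    using assms(1) by (auto simp: interval_in_def)
  have ab: "a + r \<le> Suc b"
    using assms(3,2) unfolding I by simp
  define p where "p q = {a + q..(if Suc q = r then b else a + q)}" for q
  have sub: "p q \<subseteq> {a..b}" if "q < r" for q
    using that ab by (auto simp: p_def)
  show ?thesis
  proof (intro exI[of _ p] conjI allI ballI impI)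
    fix q assume q: "q < r"
    show "p q \<subseteq> I"
      using sub[OF q] I(1) by simp
    have "p q \<subseteq> {1..n}"
      using sub[OF q] I(2) by (rule subset_trans)
    moreover have "a + q \<le> (if Suc q = r then b else a + q)"
      using ab by auto
    ultimately show "interval_in n (p q)"
      unfolding interval_in_def p_def by blast
  next
    fix v assume v: "v \<in> I"
    \<comment> \<open>The slice of \<open>v\<close> is its offset from \<open>a\<close>, capped at
      the last slice.\<close>
    show "\<exists>q<r. v \<in> p q"
      using v ab assms(2) I(1) by (intro exI[of _ "min (r - 1) (v - a)"]) (auto simp: p_def min_def)
  next
    fix v q q' assume "q < r" "q' < r" "v \<in> p q" "v \<in> p q'"
    then show "q = q'"
      by (auto simp: p_def split: if_splits)
  qed
qed

text \<open>The blow-up map: each coarse coordinate is replaced by a block of \<open>r\<close>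
  consecutive values, counted from 1. The cap lets the last block absorb the remainder, so that the
  fine side length need not be a multiple of \<open>r\<close>.\<close>

definition coarsen :: "nat \<Rightarrow> nat \<Rightarrow> nat \<Rightarrow> nat" where
  "coarsen N r v = min N (Suc ((v - 1) div r))"

lemma coarsen_mem: "0 < N \<Longrightarrow> coarsen N r v \<in> {1..N}"
  by (simp add: coarsen_def)

text \<open>The preimage of an interval is a union of consecutive blocks, each of length at least
  \<open>r\<close>.\<close>

lemma coarsen_vimage_interval:
  assumes "interval_in N I" "0 < r" "N * r \<le> n"
  defines "V \<equiv> {v \<in> {1..n}. coarsen N r v \<in> I}"
  shows "interval_in n V" "r \<le> card V"
proof -
  obtain a b where I: "I = {a..b}" "a \<le> b" and "{a..b} \<subseteq> {1..N}"
    using assms(1) by (auto simp: interval_in_def)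
  then have ab: "1 \<le> a" "b \<le> N"
    by auto
  \<comment> \<open>The right end is that of block \<open>b\<close>, except that the last block
    reaches up to \<open>n\<close>.\<close>
  define t where "t = (if b = N then n else b * r)"
  have t: "b * r \<le> t" "t \<le> n"
    using order_trans[OF mult_le_mono1[OF ab(2), of r] assms(3)] unfolding t_def by auto
  have V: "V = {(a - 1) * r + 1..t}"
  proof (intro set_eqI iffI)
    fix v assume "v \<in> V"
    then have v: "1 \<le> v" "v \<le> n" "a \<le> coarsen N r v" "coarsen N r v \<le> b"
      by (auto simp: V_def I)
    have "a - 1 \<le> (v - 1) div r"
      using v(3) unfolding coarsen_def by linarith
    then have "(a - 1) * r \<le> v - 1"
      using assms(2) by (simp add: less_eq_div_iff_mult_less_eq)
    moreover have "v \<le> t"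
    proof (cases "b = N")
      case False
      then have "(v - 1) div r < b"
        using v(4) ab by (auto simp: coarsen_def)
      then have "v - 1 < b * r"
        using assms(2) by (simp add: div_less_iff_less_mult)
      then show ?thesis
        using False by (simp add: t_def)
    qed (simp add: t_def v)
    ultimately show "v \<in> {(a - 1) * r + 1..t}"
      using v by auto
  next
    fix v assume v: "v \<in> {(a - 1) * r + 1..t}"
    then have "(a - 1) * r \<le> v - 1"
      by auto
    then have "a - 1 \<le> (v - 1) div r"
      using assms(2) by (simp add: less_eq_div_iff_mult_less_eq)
    then have "a \<le> coarsen N r v"
      using ab I by (simp add: coarsen_def)
    moreover have "coarsen N r v \<le> b"
    proof (cases "b = N")
      case False
      then have "v - 1 < b * r"
        using v by (auto simp: t_def)
      then have "(v - 1) div r < b"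
        using assms(2) by (simp add: div_less_iff_less_mult)
      then show ?thesis
        by (simp add: coarsen_def)
    qed (simp add: coarsen_def)
    ultimately show "v \<in> V"
      using v t by (auto simp: V_def I)
  qed
  have "(a - 1) * r + r \<le> t"
  proof -
    have "Suc (a - 1) * r \<le> b * r"
      using ab I(2) by (intro mult_le_mono1) simp
    then show ?thesis
      using t by simp
  qed
  then show "interval_in n V" "r \<le> card V"
    using t assms(2) unfolding V interval_in_def by auto
qed

text \<open>Blow up a single-coloured scheme so that every box has length at least \<open>r\<close>, then slice each
  box orthogonally to its label; the colour is the number of the slice.\<close>

lemma piercing_scheme_slice:
  assumes S: "piercing_scheme N D 1 J F l c" and "0 < N" "0 < r" "N * r \<le> n"
  shows "\<exists>F'. piercing_scheme n D r (J \<times> {..<r}) F' (l \<circ> fst) snd"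
proof -
  define V where "V j i = {v \<in> {1..n}. coarsen N r v \<in> F j i}" for j i
  have V: "interval_in n (V j i)" "r \<le> card (V j i)" if "j \<in> J" "i \<in> D" for j i
    unfolding V_def
    by (rule coarsen_vimage_interval[OF scheme_interval[OF S that] assms(3,4)])+
  let ?slicing = "\<lambda>j p. (\<forall>q<r. interval_in n (p q) \<and> p q \<subseteq> V j (l j)) \<and>
    (\<forall>v\<in>V j (l j). \<exists>q<r. v \<in> p q) \<and>
    (\<forall>v. \<forall>q<r. \<forall>q'<r. v \<in> p q \<longrightarrow> v \<in> p q' \<longrightarrow> q = q')"
  have "\<forall>j\<in>J. \<exists>p. ?slicing j p"
    using V scheme_label[OF S] \<open>0 < r\<close> by (intro ballI interval_in_slices) auto
  from bchoice[OF this] obtain p where slicing: "\<forall>j\<in>J. ?slicing j (p j)"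
    by blast
  have p: "\<And>j q. j \<in> J \<Longrightarrow> q < r \<Longrightarrow> interval_in n (p j q)"
    "\<And>j q. j \<in> J \<Longrightarrow> q < r \<Longrightarrow> p j q \<subseteq> V j (l j)"
    "\<And>j v. j \<in> J \<Longrightarrow> v \<in> V j (l j) \<Longrightarrow> \<exists>q<r. v \<in> p j q"
    "\<And>j v q q'. j \<in> J \<Longrightarrow> q < r \<Longrightarrow> q' < r \<Longrightarrow> v \<in> p j q \<Longrightarrow> v \<in> p j q' \<Longrightarrow> q = q'"
    using slicing by blast+
  \<comment> \<open>Only the factor in the direction of the label is cut.\<close>
  define F' where "F' jq = (V (fst jq))(l (fst jq) := p (fst jq) (snd jq))" for jq
  have coarse: "coarsen N r \<circ> x \<in> D \<rightarrow> {1..N}" for x :: "nat \<Rightarrow> nat"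
    using coarsen_mem[OF \<open>0 < N\<close>] by simp
  have V_iff: "x \<in> Pi E (V j) \<longleftrightarrow> coarsen N r \<circ> x \<in> Pi E (F j)"
    if "x \<in> D \<rightarrow> {1..n}" "E \<subseteq> D" for x E j
    using that by (auto simp: V_def Pi_iff)
  have F'_iff: "x \<in> Pi D (F' (j, q)) \<longleftrightarrow> x \<in> Pi D (V j) \<and> x (l j) \<in> p j q"
    if "j \<in> J" "q < r" for x j q
    using that p(2)[OF that] scheme_label[OF S that(1)] by (auto simp: F'_def Pi_iff)
  have "piercing_scheme n D r (J \<times> {..<r}) F' (l \<circ> fst) snd"
  proof (rule piercing_schemeI)
    show "finite (J \<times> {..<r})"
      using scheme_finite[OF S] by simp
    show "(l \<circ> fst) jq \<in> D" "snd jq < r" if "jq \<in> J \<times> {..<r}" for jq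
      using that scheme_label[OF S] by auto
    show "interval_in n (F' jq i)" if "jq \<in> J \<times> {..<r}" "i \<in> D" for jq i
      using that V p(1) by (auto simp: F'_def)
  next
    fix x assume x: "x \<in> D \<rightarrow> {1..n}"
    obtain j where j: "j \<in> J" "x \<in> Pi D (V j)"
      using scheme_ex[OF S coarse[of x]] V_iff[OF x order_refl] by auto
    then have "x (l j) \<in> V j (l j)"
      using scheme_label[OF S] by auto
    then obtain q where "q < r" "x (l j) \<in> p j q"
      using p(3) j(1) by blast
    then show "\<exists>jq\<in>J \<times> {..<r}. x \<in> Pi D (F' jq)"
      using j F'_iff by blast
  next
    fix x and a b
    assume x: "x \<in> D \<rightarrow> {1..n}" and ab: "a \<in> J \<times> {..<r}" "b \<in> J \<times> {..<r}"
      and xa: "x \<in> Pi D (F' a)" "x \<in> Pi D (F' b)"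
    obtain j q j' q' where [simp]: "a = (j, q)" "b = (j', q')"
      by fastforce
    have "j = j'"
      using scheme_unique[OF S coarse[of x]] ab xa F'_iff V_iff[OF x order_refl] by auto
    then show "a = b"
      using p(4) ab xa F'_iff by auto
  next
    fix x i q assume x: "x \<in> D \<rightarrow> {1..n}" and i: "i \<in> D" and q: "q < r"
    \<comment> \<open>Colour 0 is the only one before slicing. The slices of box \<open>j\<close>
      differ only in direction \<open>i\<close>, so the line meets all of them, in particular slice
      \<open>q\<close>.\<close>
    obtain j where j: "j \<in> J" "l j = i" "coarsen N r \<circ> x \<in> Pi (D - {i}) (F j)"
      using scheme_pierce[OF S coarse i, of 0] by auto
    then have "x \<in> Pi (D - {i}) (V j)"
      using V_iff[OF x Diff_subset] by auto
    then have "x \<in> Pi (D - {i}) (F' (j, q))"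
      using j(2) by (auto simp: F'_def)
    then show "\<exists>jq\<in>J \<times> {..<r}. (l \<circ> fst) jq = i \<and> snd jq = q \<and> x \<in> Pi (D - {i}) (F' jq)"
      using j q by force
  qed
  then show ?thesis
    by (intro exI[of _ F'])
qed

section \<open>Products of two-coloured schemes\<close>

text \<open>Two colours are what the label of a product box needs: if the colours of its factors agree
  it serves the lines in the first block of directions, otherwise those in the second.\<close>

lemma piercing_scheme_product:
  assumes S: "piercing_scheme n D 2 J F l c" and S': "piercing_scheme n D' 2 J' F' l' c'"
    and disj: "D \<inter> D' = {}"
  shows "piercing_scheme n (D \<union> D') 1 (J \<times> J')
    (\<lambda>(a, b) i. if i \<in> D then F a i else F' b i)
    (\<lambda>(a, b). if c a = c' b then l a else l' b) (\<lambda>_. 0)"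
    (is "piercing_scheme n ?D 1 _ ?F ?l _")
proof (rule piercing_schemeI)
  \<comment> \<open>The set \<open>E\<close> is empty for membership in a box and \<open>{i}\<close>
    for lines in direction \<open>i\<close>.\<close>
  have F_iff: "x \<in> Pi (?D - E) (?F (a, b)) \<longleftrightarrow> x \<in> Pi (D - E) (F a) \<and> x \<in> Pi (D' - E) (F' b)"
    for x E a b
    using disj by (auto simp: Pi_iff)
  note F_iff0 = F_iff[of _ "{}", unfolded Diff_empty]
  show "finite (J \<times> J')"
    using scheme_finite[OF S] scheme_finite[OF S'] by simp
  show "?l ab \<in> ?D" if "ab \<in> J \<times> J'" for ab
    using that scheme_label[OF S] scheme_label[OF S'] by auto
  show "(0::nat) < 1"
    by simp
  show "interval_in n (?F ab i)" if "ab \<in> J \<times> J'" "i \<in> ?D" for ab i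
    using that scheme_interval[OF S] scheme_interval[OF S'] by auto
  fix x assume "x \<in> ?D \<rightarrow> {1..n}"
  then have x: "x \<in> D \<rightarrow> {1..n}" "x \<in> D' \<rightarrow> {1..n}"
    by auto
  obtain a b where a: "a \<in> J" "x \<in> Pi D (F a)" and b: "b \<in> J'" "x \<in> Pi D' (F' b)"
    using scheme_ex[OF S x(1)] scheme_ex[OF S' x(2)] by blast
  show "\<exists>ab\<in>J \<times> J'. x \<in> Pi ?D (?F ab)"
    using a b F_iff0 by blast
  show "ab = ab'" if "ab \<in> J \<times> J'" "ab' \<in> J \<times> J'" "x \<in> Pi ?D (?F ab)" "x \<in> Pi ?D (?F ab')"
    for ab ab'
  proof -
    obtain e f e' f' where [simp]: "ab = (e, f)" "ab' = (e', f')"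
      by fastforce
    show ?thesis
      using that scheme_unique[OF S x(1)] scheme_unique[OF S' x(2)] F_iff0 by auto
  qed
  fix i and q :: nat assume i: "i \<in> ?D" and q: "q < 1"
  consider "i \<in> D" "i \<notin> D'" | "i \<notin> D" "i \<in> D'"
    using i disj by blast
  then have "\<exists>ab\<in>J \<times> J'. ?l ab = i \<and> x \<in> Pi (?D - {i}) (?F ab)"
  proof cases
    case 1
    \<comment> \<open>A line in the first block stays in box \<open>b\<close> of the second factor;
      among the boxes it meets in the first factor, one has the colour of \<open>b\<close>.\<close>
    obtain e where e: "e \<in> J" "l e = i" "c e = c' b" "x \<in> Pi (D - {i}) (F e)"
      using scheme_pierce[OF S x(1) 1(1) scheme_colour[OF S' b(1)]] by blast
    have "x \<in> Pi (?D - {i}) (?F (e, b))"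
      using F_iff e b by auto
    then show ?thesis
      using e b by force
  next
    case 2
    \<comment> \<open>Now box \<open>a\<close> is fixed, and \<open>1 - c a\<close> is the other
      colour, which makes the product box take its label from the second factor.\<close>
    have "c a < 2" "1 - c a < 2"
      using scheme_colour[OF S a(1)] by auto
    then obtain f where f: "f \<in> J'" "l' f = i" "c' f = 1 - c a" "x \<in> Pi (D' - {i}) (F' f)"
      using scheme_pierce[OF S' x(2) 2(2)] by blast
    have "c a \<noteq> c' f"
      using \<open>c a < 2\<close> f(3) by presburger
    moreover have "x \<in> Pi (?D - {i}) (?F (a, f))"
      using F_iff a f by auto
    ultimately show ?thesis
      using a f by (intro bexI[of _ "(a, f)"]) auto
  qed
  then show "\<exists>ab\<in>J \<times> J'. ?l ab = i \<and> 0 = q \<and> x \<in> Pi (?D - {i}) (?F ab)"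
    using q by auto
qed

section \<open>Attainable sizes and their recursion\<close>

text \<open>Indices are natural numbers because an existential cannot range over types. The side
  length is left free because slicing can enlarge it.\<close>

definition has_scheme :: "nat set \<Rightarrow> nat \<Rightarrow> bool" where
  "has_scheme D g \<longleftrightarrow> (\<exists>N (J :: nat set) F l c. 0 < N \<and> piercing_scheme N D 1 J F l c \<and> card J = g)"

lemma has_schemeI:
  fixes J :: "'a set"
  assumes "0 < N" and S: "piercing_scheme N D 1 J F l c"
  shows "has_scheme D (card J)"
proof -
  obtain h where h: "bij_betw h {0..<card J} J"
    using ex_bij_betw_nat_finite[OF scheme_finite[OF S]] by blast
  show ?thesis
    unfolding has_scheme_def
    using piercing_scheme_reindex[OF S h] assms(1) bij_betw_same_card[OF h] by blast
qed

text \<open>Each factor is first cut into two colours, which doubles both sizes and gives the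
  4.\<close>

lemma has_scheme_Un:
  assumes "has_scheme D g" "has_scheme D' g'" "D \<inter> D' = {}"
  shows "has_scheme (D \<union> D') (4 * g * g')"
proof -
  obtain N and J :: "nat set" and F l c
    where S: "0 < N" "piercing_scheme N D 1 J F l c" "card J = g"
    using assms(1) unfolding has_scheme_def by blast
  obtain N' and J' :: "nat set" and F' l' c'
    where S': "0 < N'" "piercing_scheme N' D' 1 J' F' l' c'" "card J' = g'"
    using assms(2) unfolding has_scheme_def by blast
  \<comment> \<open>A common side length with room for two slices in every box of either
    factor.\<close>
  define n where "n = max N N' * 2"
  obtain G where G: "piercing_scheme n D 2 (J \<times> {..<2}) G (l \<circ> fst) snd"
    using piercing_scheme_slice[OF S(2,1), of 2 n] by (auto simp: n_def)
  obtain G' where G': "piercing_scheme n D' 2 (J' \<times> {..<2}) G' (l' \<circ> fst) snd"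
    using piercing_scheme_slice[OF S'(2,1), of 2 n] by (auto simp: n_def)
  have "0 < n"
    using S(1) by (simp add: n_def)
  from has_schemeI[OF this piercing_scheme_product[OF G G' assms(3)]] show ?thesis
    using S(3) S'(3) by (simp add: card_cartesian_product algebra_simps)
qed

lemma has_scheme_singleton: "has_scheme {i} 1"
proof -
  have "interval_in 1 {1}"
    unfolding interval_in_def by (intro exI[of _ 1]) simp
  then have "piercing_scheme 1 {i} 1 {0::nat} (\<lambda>_ _. {1}) (\<lambda>_. i) (\<lambda>_. 0)"
    by (intro piercing_schemeI) auto
  from has_schemeI[OF _ this] show ?thesis
    by simp
qed

section \<open>The three-dimensional scheme with fifteen boxes\<close>

text \<open>A scheme of fifteen boxes in \<open>[4]\<^sup>3\<close>, found with a SAT solver: the end points of the three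
  factors, then the label.\<close>

definition boxes15 :: "((nat \<times> nat) \<times> (nat \<times> nat) \<times> (nat \<times> nat) \<times> nat) list" where
  "boxes15 =
    [((3,3), (1,3), (1,1), 0), ((1,2), (1,2), (2,4), 0), ((4,4), (3,4), (1,3), 0),
     ((3,3), (4,4), (4,4), 0), ((3,3), (2,3), (3,4), 0),
     ((1,3), (4,4), (1,2), 1), ((1,2), (3,3), (2,4), 1), ((4,4), (2,2), (1,3), 1),
     ((3,4), (1,1), (3,4), 1), ((1,2), (4,4), (4,4), 1),
     ((1,2), (1,3), (1,1), 2), ((1,3), (4,4), (3,3), 2), ((4,4), (1,1), (1,2), 2),
     ((4,4), (2,4), (4,4), 2), ((3,3), (1,3), (2,2), 2)]"

fun in_range :: "nat \<Rightarrow> nat \<times> nat \<Rightarrow> bool" where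
  "in_range v (p, q) \<longleftrightarrow> p \<le> v \<and> v \<le> q"

lemma boxes15_wf:
  "\<forall>(X, Y, Z, t) \<in> set boxes15.
     \<forall>I \<in> {X, Y, Z}. 1 \<le> fst I \<and> fst I \<le> snd I \<and> snd I \<le> 4"
  unfolding boxes15_def by simp

text \<open>Existence and uniqueness of the box of a point in one executable test over all 64
  points.\<close>

lemma boxes15_partition:
  "\<forall>u\<in>set [1..<5]. \<forall>v\<in>set [1..<5]. \<forall>w\<in>set [1..<5].
     length (filter (\<lambda>(X, Y, Z, t). in_range u X \<and> in_range v Y \<and> in_range w Z) boxes15) = 1"
  by code_simp

text \<open>Here \<open>u\<close> and \<open>v\<close> are the two fixed coordinates of a line; the
  conjuncts treat the three directions in turn.\<close>

lemma boxes15_pierce: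
  "\<forall>u\<in>set [1..<5]. \<forall>v\<in>set [1..<5].
     (\<exists>(X, Y, Z, t) \<in> set boxes15. t = 0 \<and> in_range u Y \<and> in_range v Z) \<and>
     (\<exists>(X, Y, Z, t) \<in> set boxes15. t = 1 \<and> in_range u X \<and> in_range v Z) \<and>
     (\<exists>(X, Y, Z, t) \<in> set boxes15. t = 2 \<and> in_range u X \<and> in_range v Y)"
  by code_simp

text \<open>The directions are arbitrary so that a triple can be appended to any
  \<open>{1..e}\<close>.\<close>

lemma has_scheme_triple:
  assumes abc: "a \<noteq> b" "a \<noteq> c" "b \<noteq> c"
  shows "has_scheme {a, b, c} 15"
proof -
  let ?D = "{a, b, c}"
  define F where "F = (\<lambda>(X, Y, Z, t :: nat) i.
    let I = if i = a then X else if i = b then Y else Z in {fst I..snd I :: nat})"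
  define l where "l = (\<lambda>(X :: nat \<times> nat, Y :: nat \<times> nat, Z :: nat \<times> nat, t :: nat).
    if t = 0 then a else if t = 1 then b else c)"
  have in_range_iff: "in_range v I \<longleftrightarrow> v \<in> {fst I..snd I}" for v I
    by (cases I) simp
  have Pi_F: "x \<in> Pi ?D (F j) \<longleftrightarrow>
    (case j of (X, Y, Z, t) \<Rightarrow> in_range (x a) X \<and> in_range (x b) Y \<and> in_range (x c) Z)" for x j
    using abc by (cases j) (auto simp: F_def in_range_iff)
  have "piercing_scheme 4 ?D 1 (set boxes15) F l (\<lambda>_. 0)"
  proof (rule piercing_schemeI)
    show "finite (set boxes15)" "(0::nat) < 1"
      by simp_all
    show "l j \<in> ?D" if "j \<in> set boxes15" for j
      by (auto simp: l_def split: prod.split)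
    show "interval_in 4 (F j i)" if ji: "j \<in> set boxes15" "i \<in> ?D" for j i
    proof -
      obtain X Y Z t where j: "j = (X, Y, Z, t)"
        by (cases j)
      define I where "I = (if i = a then X else if i = b then Y else Z)"
      have I: "I \<in> {X, Y, Z}" "F j i = {fst I..snd I}"
        by (simp_all add: I_def F_def j Let_def)
      then have "1 \<le> fst I" "fst I \<le> snd I" "snd I \<le> 4"
        using boxes15_wf ji(1) by (auto simp: j)
      then show ?thesis
        unfolding interval_in_def I(2) by auto
    qed
    fix x assume "x \<in> ?D \<rightarrow> {1..4::nat}"
    then have x: "x a \<in> set [1..<5]" "x b \<in> set [1..<5]" "x c \<in> set [1..<5]"
      by auto
    have "length (filter (\<lambda>j. x \<in> Pi ?D (F j)) boxes15) = 1"
      unfolding Pi_F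
      by (rule boxes15_partition[THEN bspec, OF x(1), THEN bspec, OF x(2), THEN bspec, OF x(3)])
    then obtain j0 where j0: "filter (\<lambda>j. x \<in> Pi ?D (F j)) boxes15 = [j0]"
      by (auto simp: length_Suc_conv)
    have mem: "j \<in> set boxes15 \<and> x \<in> Pi ?D (F j) \<longleftrightarrow> j = j0" for j
      using arg_cong[OF j0, of set] by auto
    show "\<exists>j\<in>set boxes15. x \<in> Pi ?D (F j)"
      using mem by blast
    show "j = j'" if "j \<in> set boxes15" "j' \<in> set boxes15"
      "x \<in> Pi ?D (F j)" "x \<in> Pi ?D (F j')" for j j'
      using that mem by metis
    fix i and q :: nat assume i: "i \<in> ?D" and q: "q < 1"
    have "\<exists>j\<in>set boxes15. l j = i \<and> x \<in> Pi (?D - {i}) (F j)"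
    proof -
      consider "i = a" | "i = b" | "i = c"
        using i by blast
      then show ?thesis
      proof cases
        case 1
        obtain X Y Z where "(X, Y, Z, 0) \<in> set boxes15" "in_range (x b) Y" "in_range (x c) Z"
          using boxes15_pierce[THEN bspec, OF x(2), THEN bspec, OF x(3), THEN conjunct1]
          by blast
        then show ?thesis
          using 1 abc by (intro bexI[of _ "(X, Y, Z, 0)"]) (auto simp: F_def in_range_iff l_def)
      next
        case 2
        obtain X Y Z where "(X, Y, Z, 1) \<in> set boxes15" "in_range (x a) X" "in_range (x c) Z"
          using boxes15_pierce[THEN bspec, OF x(1), THEN bspec, OF x(3), THEN conjunct2, THEN conjunct1]
          by blast
        then show ?thesis
          using 2 abc by (intro bexI[of _ "(X, Y, Z, 1)"]) (auto simp: F_def in_range_iff l_def)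
      next
        case 3
        obtain X Y Z where "(X, Y, Z, 2) \<in> set boxes15" "in_range (x a) X" "in_range (x b) Y"
          using boxes15_pierce[THEN bspec, OF x(1), THEN bspec, OF x(2), THEN conjunct2, THEN conjunct2]
          by blast
        then show ?thesis
          using 3 abc by (intro bexI[of _ "(X, Y, Z, 2)"]) (auto simp: F_def in_range_iff l_def)
      qed
    qed
    then show "\<exists>j\<in>set boxes15. l j = i \<and> 0 = q \<and> x \<in> Pi (?D - {i}) (F j)"
      using q by auto
  qed
  moreover have "card (set boxes15) = 15"
    unfolding boxes15_def by simp
  ultimately show ?thesis
    using has_schemeI[of 4 ?D "set boxes15" F l] by simp
qed

section \<open>The exponential bound\<close>

text \<open>Induction in steps of three, from sizes 1, 4 and 15 in dimensions 1, 2 and 3. A step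
  costs the factor 4 * 15 = 60, while 3.92 cubed is about 60.24.\<close>

lemma has_scheme_bound:
  assumes "1 \<le> d"
  shows "\<exists>g. has_scheme {1..d} g \<and> real g \<le> 3.92 ^ d"
  using assms
proof (induction d rule: less_induct)
  case (less d)
  consider "d = 1" | "d = 2" | "d = 3" | "3 < d"
    using less.prems by linarith
  then show ?case
  proof cases
    case 1
    then show ?thesis
      using has_scheme_singleton[of 1] by (intro exI[of _ 1]) simp
  next
    case 2
    have "{1..2} = {1::nat} \<union> {2}"
      by auto
    then have "has_scheme {1..2} 4"
      using has_scheme_Un[OF has_scheme_singleton[of 1] has_scheme_singleton[of 2]] by simp
    then show ?thesis
      using 2 by (intro exI[of _ 4]) (simp add: power2_eq_square)
  next
    case 3
    have "{1..3} = {1::nat, 2, 3}"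
      by auto
    then have "has_scheme {1..3} 15"
      using has_scheme_triple[of 1 2 3] by simp
    then show ?thesis
      using 3 by (intro exI[of _ 15]) (simp add: power3_eq_cube)
  next
    case 4
    define e where "e = d - 3"
    have e: "d = e + 3" "1 \<le> e" "e < d"
      using 4 by (auto simp: e_def)
    obtain g where g: "has_scheme {1..e} g" "real g \<le> 3.92 ^ e"
      using less.IH[OF e(3,2)] by blast
    have "{1..d} = {1..e} \<union> {e + 1, e + 2, e + 3}"
      using e by auto
    moreover have "has_scheme ({1..e} \<union> {e + 1, e + 2, e + 3}) (4 * g * 15)"
      by (intro has_scheme_Un g has_scheme_triple) auto
    ultimately have "has_scheme {1..d} (60 * g)"
      by (simp add: algebra_simps)
    moreover have "real (60 * g) \<le> 3.92 ^ e * 3.92 ^ 3"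
    proof -
      have "real (60 * g) \<le> 60 * 3.92 ^ e"
        using g(2) by simp
      also have "\<dots> \<le> 3.92 ^ 3 * 3.92 ^ e"
        by (intro mult_right_mono) (simp_all add: power3_eq_cube)
      finally show ?thesis
        by (simp add: mult.commute)
    qed
    ultimately show ?thesis
      unfolding e(1) power_add by blast
  qed
qed

section \<open>From schemes to partitions of the grid into bricks\<close>

context
  fixes n d k :: nat and J :: "'a set" and F l c
  assumes S: "piercing_scheme n {1..d} k J F l c"
begin

lemma scheme_brick_nonempty:
  assumes "j \<in> J"
  shows "Pi\<^sub>E {1..d} (F j) \<noteq> {}"
  using scheme_interval[OF S assms] by (fastforce simp: PiE_eq_empty_iff interval_in_def)

lemma scheme_brick_subset:
  assumes "j \<in> J"
  shows "Pi\<^sub>E {1..d} (F j) \<subseteq> grid n d"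
  unfolding grid_def
  using scheme_interval[OF S assms] by (intro PiE_mono) (auto simp: interval_in_def)

lemma scheme_bricks_disjoint:
  assumes "j \<in> J" "j' \<in> J" "x \<in> Pi\<^sub>E {1..d} (F j)" "x \<in> Pi\<^sub>E {1..d} (F j')"
  shows "j = j'"
proof -
  have "x \<in> {1..d} \<rightarrow> {1..n}"
    using subsetD[OF scheme_brick_subset[OF assms(1)] assms(3)] by (auto simp: grid_def)
  then show ?thesis
    using scheme_unique[OF S _ assms(1,2)] assms(3,4) by (simp add: PiE_def)
qed

lemma scheme_partition: "partition_on (grid n d) ((\<lambda>j. Pi\<^sub>E {1..d} (F j)) ` J)"
proof (rule partition_onI)
  show "{} \<notin> (\<lambda>j. Pi\<^sub>E {1..d} (F j)) ` J"
    using scheme_brick_nonempty by blast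
  show "disjnt p p'" if "p \<in> (\<lambda>j. Pi\<^sub>E {1..d} (F j)) ` J"
    "p' \<in> (\<lambda>j. Pi\<^sub>E {1..d} (F j)) ` J" "p \<noteq> p'" for p p'
    using that scheme_bricks_disjoint unfolding disjnt_def by blast
  show "\<Union> ((\<lambda>j. Pi\<^sub>E {1..d} (F j)) ` J) = grid n d"
  proof
    show "\<Union> ((\<lambda>j. Pi\<^sub>E {1..d} (F j)) ` J) \<subseteq> grid n d"
      using scheme_brick_subset by blast
    show "grid n d \<subseteq> \<Union> ((\<lambda>j. Pi\<^sub>E {1..d} (F j)) ` J)"
      using scheme_ex[OF S] by (fastforce simp: grid_def PiE_def)
  qed
qed

text \<open>The piercing condition ignores coordinate \<open>i\<close>, and the factor of the box
  there is nonempty, so moving \<open>x\<close> along direction \<open>i\<close> reaches an actual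
  point of the brick.\<close>

lemma scheme_line:
  assumes x: "x \<in> {1..d} \<rightarrow> {1..n}" and i: "i \<in> {1..d}" and "q < k"
  obtains j y where "j \<in> J" "c j = q" "y \<in> Pi\<^sub>E {1..d} (F j)" "\<forall>e\<in>{1..d} - {i}. y e = x e"
proof -
  obtain j where j: "j \<in> J" "c j = q" "x \<in> Pi ({1..d} - {i}) (F j)"
    using scheme_pierce[OF S assms] by blast
  obtain v where v: "v \<in> F j i"
    using scheme_interval[OF S j(1) i] by (fastforce simp: interval_in_def)
  have y: "restrict (x(i := v)) {1..d} \<in> Pi\<^sub>E {1..d} (F j)"
    using j(3) v by auto
  show thesis
    by (rule that[OF j(1,2) y]) simp
qed

text \<open>Every line meets a brick of each of the \<open>k\<close> colours, and these bricks are
  distinct.\<close>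

lemma scheme_k_piercing:
  assumes "1 \<le> n"
  shows "k_piercing n d k ((\<lambda>j. Pi\<^sub>E {1..d} (F j)) ` J)" (is "k_piercing n d k ?P")
  unfolding k_piercing_def
proof (intro allI impI)
  fix L assume "axis_parallel_line n d L"
  then obtain i x where i: "i \<in> {1..d}" and x: "\<forall>j\<in>{1..d} - {i}. x j \<in> {1..n}"
    and L: "L = {y \<in> grid n d. \<forall>j\<in>{1..d} - {i}. y j = x j}"
    unfolding axis_parallel_line_def by blast
  \<comment> \<open>The line leaves \<open>x i\<close> unconstrained; 1 is a filler inside the
    grid.\<close>
  have x1: "x(i := 1) \<in> {1..d} \<rightarrow> {1..n}"
    using x assms by auto
  have "\<exists>j. j \<in> J \<and> c j = q \<and> Pi\<^sub>E {1..d} (F j) \<inter> L \<noteq> {}" if q: "q < k" for q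
  proof -
    obtain j y where "j \<in> J" "c j = q" "y \<in> Pi\<^sub>E {1..d} (F j)"
      "\<forall>e\<in>{1..d} - {i}. y e = (x(i := 1)) e"
      by (rule scheme_line[OF x1 i q])
    moreover from this have "y \<in> L"
      using scheme_brick_subset unfolding L by fastforce
    ultimately show ?thesis
      by blast
  qed
  then obtain f where f: "\<And>q. q < k \<Longrightarrow> f q \<in> J" "\<And>q. q < k \<Longrightarrow> c (f q) = q"
    "\<And>q. q < k \<Longrightarrow> Pi\<^sub>E {1..d} (F (f q)) \<inter> L \<noteq> {}"
    by metis
  \<comment> \<open>Bricks are nonempty and disjoint, so a brick determines its index and hence its
    colour.\<close>
  have "inj_on (\<lambda>q. Pi\<^sub>E {1..d} (F (f q))) {..<k}"
  proof (rule inj_onI)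
    fix q q' assume q: "q \<in> {..<k}" "q' \<in> {..<k}"
      and eq: "Pi\<^sub>E {1..d} (F (f q)) = Pi\<^sub>E {1..d} (F (f q'))"
    then have fq: "f q \<in> J" "f q' \<in> J"
      using f(1) by simp_all
    obtain y where "y \<in> Pi\<^sub>E {1..d} (F (f q))"
      using scheme_brick_nonempty[OF fq(1)] by blast
    then have "f q = f q'"
      using scheme_bricks_disjoint[OF fq] eq by simp
    then show "q = q'"
      using f(2) q by (metis lessThan_iff)
  qed
  moreover have "(\<lambda>q. Pi\<^sub>E {1..d} (F (f q))) ` {..<k} \<subseteq> {B \<in> ?P. B \<inter> L \<noteq> {}}"
    using f by auto
  moreover have "finite {B \<in> ?P. B \<inter> L \<noteq> {}}"
    using scheme_finite[OF S] by simp
  ultimately have "card {..<k} \<le> card {B \<in> ?P. B \<inter> L \<noteq> {}}"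
    by (rule card_inj_on_le)
  then show "k \<le> card {B \<in> ?P. B \<inter> L \<noteq> {}}"
    by simp
qed

text \<open>A box of full length in some direction contains a whole line in this direction, which would
  then meet no other box.\<close>

lemma scheme_proper:
  assumes "2 \<le> k" "j \<in> J"
  shows "proper_brick n d (Pi\<^sub>E {1..d} (F j))"
proof -
  have "F j i \<noteq> {1..n}" if i: "i \<in> {1..d}" for i
  proof
    assume full: "F j i = {1..n}"
    obtain x where x: "x \<in> Pi\<^sub>E {1..d} (F j)"
      using scheme_brick_nonempty[OF assms(2)] by blast
    have xn: "x \<in> {1..d} \<rightarrow> {1..n}"
      using subsetD[OF scheme_brick_subset[OF assms(2)] x] by (auto simp: grid_def)
    \<comment> \<open>A brick of colour \<open>q\<close> on the line through \<open>x\<close> in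
      direction \<open>i\<close> shares the point \<open>y\<close> with brick \<open>j\<close>,
      hence equals it. So \<open>j\<close> would have both colours 0 and 1.\<close>
    have "c j = q" if q: "q < k" for q
    proof -
      obtain j' y where j': "j' \<in> J" "c j' = q" "y \<in> Pi\<^sub>E {1..d} (F j')"
        "\<forall>e\<in>{1..d} - {i}. y e = x e"
        by (rule scheme_line[OF xn i q])
      have "y i \<in> {1..n}"
        using PiE_mem[OF subsetD[OF scheme_brick_subset[OF j'(1)] j'(3), unfolded grid_def] i] .
      have "y e \<in> F j e" if "e \<in> {1..d}" for e
        using that full \<open>y i \<in> {1..n}\<close> j'(4) x by (cases "e = i") (auto simp: PiE_iff)
      then have "y \<in> Pi\<^sub>E {1..d} (F j)"
        using j'(3) by (auto simp: PiE_iff)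
      then show ?thesis
        using scheme_bricks_disjoint[OF assms(2) j'(1) _ j'(3)] j'(2) by simp
    qed
    from this[of 0] this[of 1] show False
      using assms(1) by simp
  qed
  then show ?thesis
    unfolding proper_brick_def using scheme_interval[OF S assms(2)] by blast
qed

end

theorem theorem1p7:
  fixes k d :: nat
  assumes "k \<ge> 2" and "d \<ge> 1"
  shows "\<forall>\<^sub>F n in sequentially. \<exists>P. partition_on (grid n d) P \<and>
    (\<forall>B\<in>P. proper_brick n d B) \<and> k_piercing n d k P \<and>
    real (card P) \<le> 3.92 ^ d * real k"
proof -
  obtain g where g: "has_scheme {1..d} g" "real g \<le> 3.92 ^ d"
    using has_scheme_bound[OF assms(2)] by blast
  then obtain N and J :: "nat set" and F l c
    where N: "0 < N" and S: "piercing_scheme N {1..d} 1 J F l c" and J: "card J = g"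
    unfolding has_scheme_def by blast
  show ?thesis
  \<comment> \<open>From \<open>N * k\<close> on, every blown-up box is long enough for
    \<open>k\<close> slices.\<close>
  proof (rule eventually_sequentiallyI[of "N * k"])
    fix n assume n: "N * k \<le> n"
    have "1 \<le> N * k"
      using N assms(1) by simp
    with n have "1 \<le> n"
      by (rule order_trans[rotated])
    obtain G where G: "piercing_scheme n {1..d} k (J \<times> {..<k}) G (l \<circ> fst) snd"
      using piercing_scheme_slice[OF S N _ n] assms(1) by auto
    let ?P = "(\<lambda>j. Pi\<^sub>E {1..d} (G j)) ` (J \<times> {..<k})"
    have "card ?P \<le> card (J \<times> {..<k})"
      by (rule card_image_le[OF scheme_finite[OF G]])
    then have "real (card ?P) \<le> real g * real k"
      using J by (simp add: card_cartesian_product flip: of_nat_mult)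
    also have "\<dots> \<le> 3.92 ^ d * real k"
      using g(2) by (rule mult_right_mono) simp
    finally show "\<exists>P. partition_on (grid n d) P \<and> (\<forall>B\<in>P. proper_brick n d B) \<and>
        k_piercing n d k P \<and> real (card P) \<le> 3.92 ^ d * real k"
      using scheme_partition[OF G] scheme_k_piercing[OF G \<open>1 \<le> n\<close>] scheme_proper[OF G assms(1)]
      by (intro exI[of _ ?P]) simp
  qed
qed

end
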